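(* Consider the scheduling Markov decision process described in the context, with optimal action-value function $Q$. Let $\mathbf{a}=(a_1,\dots,a_N)$ be any admissible action, let $n\in\{1,\dots,N\}$, and let $\mathbf{s}=(\bm{\tau},\mathbf{H})$ and $\mathbf{s}'_{\mathrm{AoI}}=(\bm{\tau}'_{(n)},\mathbf{H})$ be states with the same channel matrix $\mathbf{H}$, where $\bm{\tau}=(\tau_1,\dots,\tau_N)$, $\bm{\tau}'_{(n)}=(\tau_1,\dots,\tau_{n-1},\tau'_n,\tau_{n+1},\dots,\tau_N)$ and $\tau'_n\ge\tau_n$. Then $$Q(\mathbf{s}'_{\mathrm{AoI}},\mathbf{a})\le Q(\mathbf{s},\mathbf{a}).$$
   Context: Setting. There are $N$ devices and $M<N$ channels; $\hat h\ge 1$ is an integer, $\mathcal{H}=\{1,\dots,\hat h\}$, and $\gamma\in(0,1)$ is a discount factor. States. A state is $\mathbf{s}=(\bm{\tau},\mathbf{H})$, where $\bm{\tau}=(\tau_1,\dots,\tau_N)$ with each $\tau_n\in\{1,2,3,\dots\}$ (the age of information, AoI, of device $n$), and $\mathbf{H}=(h_{n,m})$ is an $N\times M$ matrix with entries in $\mathcal{H}$ (the channel states). Actions. An admissible action is $\mathbf{a}=(a_1,\dots,a_N)\in\{0,1,\dots,M\}^N$ such that for every $m\in\{1,\dots,M\}$ there is exactly one $n$ with $a_n=m$. Here $a_n=m\ge 1$ means device $n$ is scheduled on channel $m$, and $a_n=0$ means device $n$ is not scheduled. Packet drop probabilities. For each pair $(n,m)$ the packet drop probability $p_{n,m}\in[0,1]$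 is a function of the channel state $h_{n,m}$ only, and it is non-decreasing in $h_{n,m}$ (a higher channel state means a larger drop probability). Transitions. The channel matrices are i.i.d. over time, with a fixed law $\operatorname{Pr}(\mathbf{H}^+)$ on $\mathcal{H}^{N\times M}$ whose entries have given distributions $\operatorname{Pr}(h_{n,m}=j)=q^{(n,m)}_j$, $\sum_{j=1}^{\hat h}q^{(n,m)}_j=1$. From state $\mathbf{s}=(\bm{\tau},\mathbf{H})$ under action $\mathbf{a}$, the next state $\mathbf{s}^+=(\bm{\tau}^+,\mathbf{H}^+)$ has probability $$\operatorname{Pr}(\mathbf{s}^+\mid\mathbf{s},\mathbf{a})=\operatorname{Pr}(\mathbf{H}^+)\prod_{n=1}^N\operatorname{Pr}(\tau_n^+\mid\tau_n,\mathbf{H},a_n),$$ where, if $a_n=m\ge1$, $\tau_n^+=1$ with probability $1-p_{n,m}$ and $\tau_n^+=\tau_n+1$ with probability $p_{n,m}$ (with $p_{n,m}$ evaluated at the current $h_{n,m}$), and, if $a_n=0$, $\tau_n^+=\tau_n+1$ with probability $1$. Reward. $r(\mathbf{s})=-\sum_{n=1}^N g_n(\tau_n)$, where each $g_n:\{1,2,\dots\}\to(0,\infty)$ is a positive non-decreasing function. Value functions. Let $\pi^*$ be an optimal stationary policy, i.e. a map from states to admissible actions that attains, from every initial state, the maximum over all policies of the expected discounted total reward. It is assumed that $\pi^*$ exists and that the value functions below are finite (real-valued). Define $$V(\mathbf{s})=\mathbb{E}\Big[\sum_{t'=t}^\infty\gamma^{t'-t}r(\mathbf{s}_{t'})\,\Big|\,\mathbf{s}_t=\mathbf{s},\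 \mathbf{a}_{t'}=\pi^*(\mathbf{s}_{t'})\ \forall t'\ge t\Big],$$ $$Q(\mathbf{s},\mathbf{a})=\mathbb{E}\Big[\sum_{t'=t}^\infty\gamma^{t'-t}r(\mathbf{s}_{t'})\,\Big|\,\mathbf{s}_t=\mathbf{s},\ \mathbf{a}_t=\mathbf{a},\ \mathbf{a}_{t'}=\pi^*(\mathbf{s}_{t'})\ \forall t'>t\Big],$$ so that $Q(\mathbf{s},\mathbf{a})=r(\mathbf{s})+\gamma\sum_{\mathbf{s}^+}\operatorname{Pr}(\mathbf{s}^+\mid\mathbf{s},\mathbf{a})V(\mathbf{s}^+)$. *)

theory Defs
  imports "HOL-Probability.Probability"
begin

section \<open>Controlled processes with countable state and action types\<close>

text \<open>
  A policy may randomise and may depend on the whole past: it receives the list of earlier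
  state-action pairs (oldest first) and the current state.
\<close>

type_synonym ('s, 'a) policy = "('s \<times> 'a) list \<Rightarrow> 's \<Rightarrow> 'a pmf"

definition admissible_policy :: "'s set \<Rightarrow> 'a set \<Rightarrow> ('s, 'a) policy \<Rightarrow> bool" where
  "admissible_policy S A \<sigma> \<longleftrightarrow> (\<forall>hist. \<forall>s\<in>S. set_pmf (\<sigma> hist s) \<subseteq> A)"

definition stationary :: "('s \<Rightarrow> 'a) \<Rightarrow> ('s, 'a) policy" where
  "stationary f = (\<lambda>hist s. return_pmf (f s))"

definition first_then :: "'a \<Rightarrow> ('s \<Rightarrow> 'a) \<Rightarrow> ('s, 'a) policy" where
  "first_then a f = (\<lambda>hist s. return_pmf (if hist = [] then a else f s))"

text \<open>
  Conditional law of the state-action pair at time \<open>i\<close>, given the pairs \<open>\<omega> 0, \<dots>, \<omega> (i - 1)\<close>;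
  \<open>K\<close> is the transition law and \<open>s\<close> the initial state.
\<close>

definition step_law ::
  "('s \<Rightarrow> 'a \<Rightarrow> 's pmf) \<Rightarrow> ('s, 'a) policy \<Rightarrow> 's \<Rightarrow> nat \<Rightarrow> (nat \<Rightarrow> 's \<times> 'a) \<Rightarrow> ('s \<times> 'a) pmf"
where
  "step_law K \<sigma> s i \<omega> =
     bind_pmf (case i of 0 \<Rightarrow> return_pmf s | Suc j \<Rightarrow> K (fst (\<omega> j)) (snd (\<omega> j)))
       (\<lambda>s'. map_pmf (Pair s') (\<sigma> (map \<omega> [0..<i]) s'))"

lemma Ionescu_Tulcea_step_law:
  fixes K :: "'s::countable \<Rightarrow> 'a::countable \<Rightarrow> 's pmf"
  shows "Ionescu_Tulcea (\<lambda>i \<omega>. measure_pmf (step_law K \<sigma> s i \<omega>)) (\<lambda>_. count_space UNIV)"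
proof
  fix i :: nat
  have "PiM {0..<i} (\<lambda>_. count_space (UNIV :: ('s \<times> 'a) set)) =
      count_space (PiE {0..<i} (\<lambda>_. UNIV))"
    by (rule count_space_PiM_finite) auto
  then show "(\<lambda>\<omega>. measure_pmf (step_law K \<sigma> s i \<omega>)) \<in>
      measurable (PiM {0..<i} (\<lambda>_. count_space UNIV)) (subprob_algebra (count_space UNIV))"
    by (simp add: measure_pmf_in_subprob_algebra)
qed

text \<open>The law on infinite trajectories with these conditional laws (Ionescu-Tulcea).\<close>

definition trajectory_measure ::
  "('s::countable \<Rightarrow> 'a::countable \<Rightarrow> 's pmf) \<Rightarrow> ('s, 'a) policy \<Rightarrow> 's \<Rightarrow> (nat \<Rightarrow> 's \<times> 'a) measure"
where
  "trajectory_measure K \<sigma> s =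
     projective_family.lim UNIV
       (Ionescu_Tulcea.CI (\<lambda>i \<omega>. measure_pmf (step_law K \<sigma> s i \<omega>)) (\<lambda>_. count_space UNIV))
       (\<lambda>_. count_space UNIV)"

text \<open>
  Expectation with values in the extended reals.  It is the usual one whenever the positive or the
  negative part is integrable; rewards below are negative, so only the value minus infinity can
  occur besides real values.
\<close>

definition ext_expectation :: "'b measure \<Rightarrow> ('b \<Rightarrow> ereal) \<Rightarrow> ereal" where
  "ext_expectation M X =
     enn2ereal (\<integral>\<^sup>+ \<omega>. e2ennreal (X \<omega>) \<partial>M) - enn2ereal (\<integral>\<^sup>+ \<omega>. e2ennreal (- X \<omega>) \<partial>M)"

definition policy_value ::
  "('s::countable \<Rightarrow> 'a::countable \<Rightarrow> 's pmf) \<Rightarrow> ('s \<Rightarrow> real) \<Rightarrow> real \<Rightarrow> ('s, 'a) policy \<Rightarrow> 's \<Rightarrow> ereal"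
where
  "policy_value K r \<gamma> \<sigma> s =
     ext_expectation (trajectory_measure K \<sigma> s) (\<lambda>\<omega>. \<Sum>t. ereal (\<gamma> ^ t * r (fst (\<omega> t))))"

definition optimal_stationary ::
  "'s set \<Rightarrow> 'a set \<Rightarrow> ('s::countable \<Rightarrow> 'a::countable \<Rightarrow> 's pmf) \<Rightarrow> ('s \<Rightarrow> real) \<Rightarrow> real \<Rightarrow>
   ('s \<Rightarrow> 'a) \<Rightarrow> bool"
where
  "optimal_stationary S A K r \<gamma> f \<longleftrightarrow>
     f \<in> S \<rightarrow> A \<and>
     (\<forall>s\<in>S. \<forall>\<sigma>. admissible_policy S A \<sigma> \<longrightarrow>
        policy_value K r \<gamma> \<sigma> s \<le> policy_value K r \<gamma> (stationary f) s)"

definition V_fun ::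
  "('s::countable \<Rightarrow> 'a::countable \<Rightarrow> 's pmf) \<Rightarrow> ('s \<Rightarrow> real) \<Rightarrow> real \<Rightarrow> ('s \<Rightarrow> 'a) \<Rightarrow> 's \<Rightarrow> ereal"
where
  "V_fun K r \<gamma> f s = policy_value K r \<gamma> (stationary f) s"

definition Q_fun ::
  "('s::countable \<Rightarrow> 'a::countable \<Rightarrow> 's pmf) \<Rightarrow> ('s \<Rightarrow> real) \<Rightarrow> real \<Rightarrow> ('s \<Rightarrow> 'a) \<Rightarrow>
   's \<Rightarrow> 'a \<Rightarrow> ereal"
where
  "Q_fun K r \<gamma> f s a = policy_value K r \<gamma> (first_then a f) s"

section \<open>The scheduling problem\<close>

text \<open>
  Devices are the elements of the finite type \<open>'n\<close>, channels those of the finite type \<open>'m\<close>.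
  An action maps each device to \<open>Some\<close> channel or to \<open>None\<close> (not scheduled).
\<close>

type_synonym ('n, 'm) channels = "'n \<Rightarrow> 'm \<Rightarrow> nat"
type_synonym ('n, 'm) state = "('n \<Rightarrow> nat) \<times> ('n, 'm) channels"
type_synonym ('n, 'm) action = "'n \<Rightarrow> 'm option"

definition channel_matrices :: "nat \<Rightarrow> ('n, 'm) channels set" where
  "channel_matrices hmax = {H. \<forall>n m. H n m \<in> {1..hmax}}"

definition states :: "nat \<Rightarrow> ('n, 'm) state set" where
  "states hmax = {\<tau>. \<forall>n. 1 \<le> \<tau> n} \<times> channel_matrices hmax"

definition actions :: "('n, 'm) action set" where
  "actions = {a. \<forall>m. \<exists>!n. a n = Some m}"

definition next_aoi ::
  "('n \<Rightarrow> 'm \<Rightarrow> nat \<Rightarrow> real) \<Rightarrow> ('n, 'm) state \<Rightarrow> ('n, 'm) action \<Rightarrow> 'n \<Rightarrow> nat pmf"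
where
  "next_aoi p s a n =
     (case a n of
        None \<Rightarrow> return_pmf (fst s n + 1)
      | Some m \<Rightarrow> map_pmf (\<lambda>dropped. if dropped then fst s n + 1 else 1)
                    (bernoulli_pmf (p n m (snd s n m))))"

text \<open>The default value \<open>0\<close> of \<open>Pi_pmf\<close> is irrelevant, as the index set is \<open>UNIV\<close>.\<close>

definition transition ::
  "('n::finite, 'm) channels pmf \<Rightarrow> ('n \<Rightarrow> 'm \<Rightarrow> nat \<Rightarrow> real) \<Rightarrow>
   ('n, 'm) state \<Rightarrow> ('n, 'm) action \<Rightarrow> ('n, 'm) state pmf"
where
  "transition chan p s a = pair_pmf (Pi_pmf UNIV 0 (next_aoi p s a)) chan"

definition reward :: "('n::finite \<Rightarrow> nat \<Rightarrow> real) \<Rightarrow> ('n, 'm) state \<Rightarrow> real" where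
  "reward g s = - (\<Sum>n\<in>UNIV. g n (fst s n))"

end

theory Submission
  imports Defs
begin

text \<open>
  Proof idea: couple the processes started from \<open>(\<tau>, H)\<close> and from the older state
  \<open>(\<tau>(n := \<tau>'), H)\<close> by the same packet drops and channel matrices.  After the common first
  action, the younger process can follow the policy that applies \<open>\<pi>\<close> to the state of
  the older one.  That state is a function of the observed history, because a real age equals 1
  exactly after a successful transmission.  Under this policy the younger process is at all times
  at most as old as the other one, hence cheaper, and optimality of \<open>\<pi>\<close> can only
  lower its cost further.
\<close>

section \<open>Discounted cost through the laws of the states\<close>

text \<open>The recursion peels off the first step and hands the remaining policy a longer history.
  This is the direction in which \<open>first_then\<close> and the coupling unfold.\<close>

primrec state_law ::
  "('s \<Rightarrow> 'a \<Rightarrow> 's pmf) \<Rightarrow> nat \<Rightarrow> ('s, 'a) policy \<Rightarrow> 's \<Rightarrow> 's pmf"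
where
  "state_law K 0 \<sigma> s = return_pmf s"
| "state_law K (Suc t) \<sigma> s =
     \<sigma> [] s \<bind> (\<lambda>a. K s a \<bind> state_law K t (\<lambda>hist. \<sigma> ((s, a) # hist)))"

lemma set_state_law_subset:
  assumes "admissible_policy S A \<sigma>" and "s \<in> S"
    and K: "\<And>s a. s \<in> S \<Longrightarrow> a \<in> A \<Longrightarrow> set_pmf (K s a) \<subseteq> S"
  shows "set_pmf (state_law K t \<sigma> s) \<subseteq> S"
  using assms(1,2)
proof (induction t arbitrary: \<sigma> s)
  case (Suc t)
  have "set_pmf (state_law K t (\<lambda>hist. \<sigma> ((s, a) # hist)) x) \<subseteq> S"
    if "a \<in> set_pmf (\<sigma> [] s)" "x \<in> set_pmf (K s a)" for a x
  proof (rule Suc.IH)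
    show "admissible_policy S A (\<lambda>hist. \<sigma> ((s, a) # hist))"
      using Suc.prems(1) by (simp add: admissible_policy_def)
    have "a \<in> A"
      using Suc.prems that(1) by (auto simp: admissible_policy_def)
    then show "x \<in> S"
      using K[OF Suc.prems(2)] that(2) by blast
  qed
  then show ?case by auto
qed auto

section \<open>One-time marginals of the Ionescu-Tulcea measure\<close>

context
  fixes K :: "'s::countable \<Rightarrow> 'a::countable \<Rightarrow> 's pmf" and \<sigma> :: "('s, 'a) policy" and s :: 's
begin

interpretation IT: Ionescu_Tulcea "\<lambda>i \<omega>. measure_pmf (step_law K \<sigma> s i \<omega>)" "\<lambda>_. count_space UNIV"
  by (rule Ionescu_Tulcea_step_law)

lemma measurable_at_time:
  "n \<in> J \<Longrightarrow> (\<lambda>\<omega>. f (fst (\<omega> n))) \<in> borel_measurable (PiM J (\<lambda>_. count_space (UNIV :: ('s \<times> 'a) set)))"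
  for f :: "'s \<Rightarrow> 'b::topological_space"
  using measurable_compose[OF measurable_component_singleton[of n J "\<lambda>_. count_space UNIV"],
      of "\<lambda>x. f (fst x)" borel] by simp

text \<open>\<open>IT.C\<close> appends kernels at the end of a trajectory, while
  \<open>state_law\<close> recurses at its start. An arbitrary prefix \<omega> of length
  \<open>n\<close> is needed to reconcile the two: the induction moves the first sampled pair into
  the prefix.\<close>

lemma nn_integral_C_state_law:
  fixes f :: "'s \<Rightarrow> ennreal"
  assumes "\<omega> \<in> space (PiM {0..<n} (\<lambda>_. count_space UNIV))"
  shows "(\<integral>\<^sup>+\<omega>'. f (fst (\<omega>' (n + t))) \<partial>IT.C n (Suc t) \<omega>) =
    (\<integral>\<^sup>+x. f x \<partial>measure_pmf ((case n of 0 \<Rightarrow> return_pmf s | Suc j \<Rightarrow> K (fst (\<omega> j)) (snd (\<omega> j))) \<bind>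
       state_law K t (\<lambda>hist. \<sigma> (map \<omega> [0..<n] @ hist))))"
  using assms
proof (induction t arbitrary: n \<omega>)
  case 0
  have "IT.C n (Suc 0) \<omega> = IT.eP n \<omega>"
    using 0 by (simp add: bind_return[OF IT.measurable_eP])
  then have "(\<integral>\<^sup>+\<omega>'. f (fst (\<omega>' (n + 0))) \<partial>IT.C n (Suc 0) \<omega>) =
      (\<integral>\<^sup>+x. f (fst x) \<partial>step_law K \<sigma> s n \<omega>)"
    using IT.nn_integral_eP[OF 0, of "\<lambda>\<omega>'. f (fst (\<omega>' n))"] measurable_at_time[of n "{0..<Suc n}" f]
    by (simp del: IT.C.simps)
  then show ?case
    by (simp add: step_law_def bind_return_pmf' del: IT.C.simps)
next
  case (Suc t)
  have upd: "(fun_upd \<omega> n x) \<in> space (PiM {0..<Suc n} (\<lambda>_. count_space UNIV))" for x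
    using Suc.prems by (auto simp: space_PiM PiE_iff extensional_def)
  have one: "IT.C n (Suc 0) \<omega> = IT.eP n \<omega>"
    using Suc.prems by (simp add: bind_return[OF IT.measurable_eP])
  \<comment> \<open>Splitting after one kernel leaves \<open>Suc t\<close> further kernels that
    start from a prefix of length \<open>Suc n\<close>, the form required by the induction
    hypothesis.\<close>
  have "IT.C n (Suc (Suc t)) \<omega> = IT.eP n \<omega> \<bind> IT.C (Suc n) (Suc t)"
    using IT.split_C[OF Suc.prems, of "Suc 0" "Suc t"] unfolding one by (simp del: IT.C.simps)
  then have "(\<integral>\<^sup>+\<omega>'. f (fst (\<omega>' (n + Suc t))) \<partial>IT.C n (Suc (Suc t)) \<omega>) =
      (\<integral>\<^sup>+\<omega>'. f (fst (\<omega>' (n + Suc t))) \<partial>(IT.eP n \<omega> \<bind> IT.C (Suc n) (Suc t)))"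
    by (simp del: IT.C.simps)
  also have "\<dots> = (\<integral>\<^sup>+\<omega>'. \<integral>\<^sup>+\<omega>''. f (fst (\<omega>'' (n + Suc t))) \<partial>IT.C (Suc n) (Suc t) \<omega>' \<partial>IT.eP n \<omega>)"
  proof (rule nn_integral_bind)
    show "(\<lambda>\<omega>'. f (fst (\<omega>' (n + Suc t)))) \<in>
        borel_measurable (PiM {0..<Suc n + Suc t} (\<lambda>_. count_space (UNIV :: ('s \<times> 'a) set)))"
      by (rule measurable_at_time) simp
    show "IT.C (Suc n) (Suc t) \<in> measurable (IT.eP n \<omega>)
        (subprob_algebra (PiM {0..<Suc n + Suc t} (\<lambda>_. count_space UNIV)))"
      using IT.measurable_C[of "Suc n" "Suc t"]
      by (simp only: measurable_cong_sets[OF IT.sets_eP[OF Suc.prems] refl])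
  qed
  also have "\<dots> = (\<integral>\<^sup>+x. \<integral>\<^sup>+\<omega>''. f (fst (\<omega>'' (Suc n + t))) \<partial>IT.C (Suc n) (Suc t) (fun_upd \<omega> n x)
      \<partial>step_law K \<sigma> s n \<omega>)"
  proof (subst IT.nn_integral_eP[OF Suc.prems])
    show "(\<lambda>\<omega>'. \<integral>\<^sup>+\<omega>''. f (fst (\<omega>'' (n + Suc t))) \<partial>IT.C (Suc n) (Suc t) \<omega>') \<in>
        borel_measurable (PiM {0..<Suc n} (\<lambda>_. count_space UNIV))"
    proof (rule measurable_compose[OF IT.measurable_C])
      show "(\<lambda>M. \<integral>\<^sup>+\<omega>''. f (fst (\<omega>'' (n + Suc t))) \<partial>M) \<in> borel_measurable
          (subprob_algebra (PiM {0..<Suc n + Suc t} (\<lambda>_. count_space (UNIV :: ('s \<times> 'a) set))))"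
        by (rule nn_integral_measurable_subprob_algebra, rule measurable_at_time) simp
    qed
  qed (simp del: IT.C.simps)
  also have "\<dots> = (\<integral>\<^sup>+x. \<integral>\<^sup>+y. f y \<partial>measure_pmf (K (fst x) (snd x) \<bind>
      state_law K t (\<lambda>hist. \<sigma> (map \<omega> [0..<n] @ x # hist))) \<partial>step_law K \<sigma> s n \<omega>)"
  proof (rule nn_integral_cong)
    fix x
    have "map (fun_upd \<omega> n x) [0..<Suc n] = map \<omega> [0..<n] @ [x]"
      by simp
    then show "(\<integral>\<^sup>+\<omega>''. f (fst (\<omega>'' (Suc n + t))) \<partial>IT.C (Suc n) (Suc t) (fun_upd \<omega> n x)) =
        (\<integral>\<^sup>+y. f y \<partial>measure_pmf (K (fst x) (snd x) \<bind>
          state_law K t (\<lambda>hist. \<sigma> (map \<omega> [0..<n] @ x # hist))))"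
      by (subst Suc.IH[OF upd]) (simp del: upt_Suc)
  qed
  also have "\<dots> = (\<integral>\<^sup>+y. f y \<partial>measure_pmf (step_law K \<sigma> s n \<omega> \<bind> (\<lambda>x. K (fst x) (snd x) \<bind>
      state_law K t (\<lambda>hist. \<sigma> (map \<omega> [0..<n] @ x # hist)))))"
    by simp
  \<comment> \<open>\<open>step_law\<close> draws first the state and then the action; reassociating
    the binds exposes the recursion of \<open>state_law\<close>.\<close>
  also have "step_law K \<sigma> s n \<omega> \<bind> (\<lambda>x. K (fst x) (snd x) \<bind>
      state_law K t (\<lambda>hist. \<sigma> (map \<omega> [0..<n] @ x # hist))) =
    (case n of 0 \<Rightarrow> return_pmf s | Suc j \<Rightarrow> K (fst (\<omega> j)) (snd (\<omega> j))) \<bind>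
       state_law K (Suc t) (\<lambda>hist. \<sigma> (map \<omega> [0..<n] @ hist))"
    by (auto simp: step_law_def map_pmf_def bind_assoc_pmf bind_return_pmf intro!: bind_pmf_cong)
  finally show ?case .
qed

lemma sets_trajectory_measure [measurable_cong]:
  "sets (trajectory_measure K \<sigma> s) = sets (PiM UNIV (\<lambda>_. count_space UNIV))"
  by (simp add: trajectory_measure_def)

lemma nn_integral_trajectory_measure:
  fixes f :: "'s \<Rightarrow> ennreal"
  shows "(\<integral>\<^sup>+\<omega>. f (fst (\<omega> t)) \<partial>trajectory_measure K \<sigma> s) = (\<integral>\<^sup>+x. f x \<partial>state_law K t \<sigma> s)"
proof -
  let ?J = "{0..<Suc t}"
  let ?M = "\<lambda>_. count_space (UNIV :: ('s \<times> 'a) set)"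
  \<comment> \<open>Since \<open>?J\<close> is an initial segment, the horizon
    \<open>IT.up_to ?J\<close> is exactly \<open>Suc t\<close>, and \<open>IT.CI ?J\<close> is the
    finite product \<open>IT.C 0 (Suc t)\<close> with no proper projection left.\<close>
  have "?J \<subseteq> {0..<IT.up_to ?J}"
    by (rule IT.up_to) simp
  moreover have "IT.up_to ?J \<le> Suc t"
    by (simp add: IT.up_to_iff)
  ultimately have up_to: "IT.up_to ?J = Suc t"
    by (simp add: order_antisym)
  have "(\<integral>\<^sup>+\<omega>. f (fst (\<omega> t)) \<partial>trajectory_measure K \<sigma> s) =
      (\<integral>\<^sup>+\<omega>. f (fst (restrict \<omega> ?J t)) \<partial>IT.PF.lim)"
    by (simp add: trajectory_measure_def)
  also have "\<dots> = (\<integral>\<^sup>+\<omega>. f (fst (\<omega> t)) \<partial>distr IT.PF.lim (PiM ?J ?M) (\<lambda>\<omega>. restrict \<omega> ?J))"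
  proof -
    have "(\<lambda>\<omega>. restrict \<omega> ?J) \<in> measurable IT.PF.lim (PiM ?J ?M)"
      by (simp add: measurable_cong_sets[OF IT.PF.sets_lim refl] measurable_restrict_subset)
    then show ?thesis
      using measurable_at_time[of t ?J f] by (subst nn_integral_distr) simp_all
  qed
  also have "distr IT.PF.lim (PiM ?J ?M) (\<lambda>\<omega>. restrict \<omega> ?J) = IT.CI ?J"
    by (rule IT.distr_lim) simp
  also have "IT.CI ?J = IT.C 0 (Suc t) (\<lambda>_. undefined)"
    unfolding IT.CI_def up_to using IT.distr_C[of "Suc t" "Suc t" "\<lambda>_. undefined" 0]
    by (simp add: space_PiM del: IT.C.simps)
  also have "(\<integral>\<^sup>+\<omega>. f (fst (\<omega> t)) \<partial>IT.C 0 (Suc t) (\<lambda>_. undefined)) =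
      (\<integral>\<^sup>+x. f x \<partial>state_law K t \<sigma> s)"
    using nn_integral_C_state_law[where \<omega> = "\<lambda>_. undefined" and n = 0 and f = f and t = t]
    by (simp add: space_PiM bind_return_pmf del: IT.C.simps)
  finally show ?thesis .
qed

end

section \<open>Discounted values as series of expected costs\<close>

definition expected_cost ::
  "('s \<Rightarrow> 'a \<Rightarrow> 's pmf) \<Rightarrow> ('s \<Rightarrow> ennreal) \<Rightarrow> real \<Rightarrow> ('s, 'a) policy \<Rightarrow> 's \<Rightarrow> ennreal"
where
  "expected_cost K c \<gamma> \<sigma> s = (\<Sum>t. ennreal (\<gamma> ^ t) * (\<integral>\<^sup>+x. c x \<partial>state_law K t \<sigma> s))"

lemma suminf_ereal_nonpos:
  assumes "\<And>t. x t \<le> 0"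
  shows "(\<Sum>t. ereal (x t)) = - enn2ereal (\<Sum>t. ennreal (- x t))"
proof -
  let ?y = "\<lambda>t. ereal (- x t)"
  have "?y = (\<lambda>t. enn2ereal (ennreal (- x t)))"
    using assms by auto
  then have "suminf ?y = enn2ereal (\<Sum>t. ennreal (- x t))"
    by (simp only: suminf_enn2ereal)
  moreover have "summable ?y"
    using assms by (intro summable_ereal_pos) simp
  ultimately have "?y sums enn2ereal (\<Sum>t. ennreal (- x t))"
    by (simp only: sums_iff)
  from tendsto_uminus_ereal[OF this[unfolded sums_def]]
  have "(\<lambda>t. ereal (x t)) sums (- enn2ereal (\<Sum>t. ennreal (- x t)))"
    unfolding sums_def sum_ereal sum_negf uminus_ereal.simps minus_minus .
  then show ?thesis
    by (rule sums_unique[symmetric])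
qed

text \<open>Rewards are nonpositive along almost every trajectory, so monotone convergence exchanges
  sum and integral without integrability assumptions. Working in \<open>ennreal\<close> also covers
  policies of infinite cost.\<close>

lemma policy_value_eq_expected_cost:
  fixes K :: "'s::countable \<Rightarrow> 'a::countable \<Rightarrow> 's pmf"
  assumes adm: "admissible_policy S A \<sigma>" "s \<in> S"
    and K: "\<And>s a. s \<in> S \<Longrightarrow> a \<in> A \<Longrightarrow> set_pmf (K s a) \<subseteq> S"
    and r: "\<And>s. s \<in> S \<Longrightarrow> r s \<le> 0" and \<gamma>: "0 \<le> \<gamma>"
  shows "policy_value K r \<gamma> \<sigma> s = - enn2ereal (expected_cost K (\<lambda>x. ennreal (- r x)) \<gamma> \<sigma> s)"
proof -
  let ?T = "trajectory_measure K \<sigma> s"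
  let ?X = "\<lambda>\<omega>. \<Sum>t. ereal (\<gamma> ^ t * r (fst (\<omega> t)))"
  let ?u = "\<lambda>t \<omega>. ennreal (\<gamma> ^ t) * ennreal (- r (fst (\<omega> t)))"
  have meas: "(\<lambda>\<omega>. f (fst (\<omega> t))) \<in> borel_measurable ?T" for t and f :: "'s \<Rightarrow> ennreal"
    using measurable_at_time[of t UNIV f]
    by (simp add: measurable_cong_sets[OF sets_trajectory_measure refl])
  \<comment> \<open>The marginals are known only through integrals, so the support statement is
    transferred by integrating the indicator of \<open>- S\<close>.\<close>
  have "AE \<omega> in ?T. fst (\<omega> t) \<in> S" for t
  proof -
    have "(\<integral>\<^sup>+x. indicator (- S) x \<partial>state_law K t \<sigma> s) = 0"
      using set_state_law_subset[where t = t, OF adm] K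
      by (subst nn_integral_0_iff_AE) (auto simp: AE_measure_pmf_iff indicator_def)
    then have "(\<integral>\<^sup>+\<omega>. indicator (- S) (fst (\<omega> t)) \<partial>?T) = 0"
      by (subst nn_integral_trajectory_measure)
    then show ?thesis
      by (subst (asm) nn_integral_0_iff_AE[OF meas]) (simp add: indicator_def if_distrib cong: if_cong)
  qed
  then have AE: "AE \<omega> in ?T. \<forall>t. fst (\<omega> t) \<in> S"
    by (simp add: AE_all_countable)
  \<comment> \<open>This makes the positive part in \<open>ext_expectation\<close> vanish and turns
    the negative part into a series of nonnegative functions.\<close>
  have X: "?X \<omega> = - enn2ereal (\<Sum>t. ?u t \<omega>)" if "\<forall>t. fst (\<omega> t) \<in> S" for \<omega>
  proof -
    have "\<gamma> ^ t * r (fst (\<omega> t)) \<le> 0" for t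
      using that r \<gamma> by (simp add: mult_nonneg_nonpos)
    moreover have "ennreal (- (\<gamma> ^ t * r (fst (\<omega> t)))) = ?u t \<omega>" for t
      using ennreal_mult'[of "\<gamma> ^ t" "- r (fst (\<omega> t))"] \<gamma> by simp
    ultimately show ?thesis
      by (subst suminf_ereal_nonpos) simp_all
  qed
  have "(\<integral>\<^sup>+\<omega>. e2ennreal (?X \<omega>) \<partial>?T) = (\<integral>\<^sup>+\<omega>. 0 \<partial>?T)"
    using AE by (intro nn_integral_cong_AE, elim AE_mp, intro AE_I2 impI)
      (simp only: X, simp add: e2ennreal_neg)
  moreover have "(\<integral>\<^sup>+\<omega>. e2ennreal (- ?X \<omega>) \<partial>?T) = (\<integral>\<^sup>+\<omega>. (\<Sum>t. ?u t \<omega>) \<partial>?T)"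
    using AE by (intro nn_integral_cong_AE, elim AE_mp, intro AE_I2 impI) (simp only: X, simp)
  moreover have "(\<integral>\<^sup>+\<omega>. (\<Sum>t. ?u t \<omega>) \<partial>?T) = (\<Sum>t. \<integral>\<^sup>+\<omega>. ?u t \<omega> \<partial>?T)"
  proof (rule nn_integral_suminf)
    show "?u t \<in> borel_measurable ?T" for t
      using meas[of "\<lambda>x. ennreal (- r x)" t] by measurable
  qed
  moreover have "(\<integral>\<^sup>+\<omega>. ?u t \<omega> \<partial>?T) =
      ennreal (\<gamma> ^ t) * (\<integral>\<^sup>+x. ennreal (- r x) \<partial>state_law K t \<sigma> s)" for t
    by (subst nn_integral_cmult[OF meas]) (simp add: nn_integral_trajectory_measure[where f = "\<lambda>x. ennreal (- r x)"])
  ultimately show ?thesis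
    by (simp add: policy_value_def ext_expectation_def expected_cost_def zero_ennreal.rep_eq)
qed

text \<open>One-step Bellman identity: the history is empty only at time 0, so
  \<open>first_then a f\<close> continues as \<open>stationary f\<close>, and every later term
  carries one extra factor \<gamma>.\<close>

lemma expected_cost_first_then:
  assumes \<gamma>: "0 \<le> \<gamma>"
  shows "expected_cost K c \<gamma> (first_then a f) s =
    c s + ennreal \<gamma> * (\<integral>\<^sup>+x. expected_cost K c \<gamma> (stationary f) x \<partial>K s a)"
proof -
  let ?D = "\<lambda>t x. \<integral>\<^sup>+y. c y \<partial>state_law K t (stationary f) x"
  have law: "state_law K (Suc t) (first_then a f) s = K s a \<bind> state_law K t (stationary f)" for t
    by (simp add: first_then_def stationary_def bind_return_pmf)
  have "expected_cost K c \<gamma> (first_then a f) s =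
      c s + (\<Sum>t. ennreal (\<gamma> ^ Suc t) * (\<integral>\<^sup>+x. ?D t x \<partial>K s a))"
    unfolding expected_cost_def
    by (subst suminf_offset[of _ "Suc 0"]) (simp_all add: law del: state_law.simps(2) power_Suc)
  also have "(\<Sum>t. ennreal (\<gamma> ^ Suc t) * (\<integral>\<^sup>+x. ?D t x \<partial>K s a)) =
      (\<Sum>t. ennreal \<gamma> * (\<integral>\<^sup>+x. ennreal (\<gamma> ^ t) * ?D t x \<partial>K s a))"
    using \<gamma> by (simp add: nn_integral_cmult ennreal_mult mult.assoc)
  also have "\<dots> = ennreal \<gamma> * (\<integral>\<^sup>+x. expected_cost K c \<gamma> (stationary f) x \<partial>K s a)"
    by (simp add: expected_cost_def nn_integral_suminf)
  finally show ?thesis .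
qed

section \<open>The coupling\<close>

text \<open>The Boolean component tells which ages are not reset: \<open>True\<close> means dropped or not scheduled.\<close>

definition noise ::
  "('n::finite, 'm) channels pmf \<Rightarrow> ('n \<Rightarrow> 'm \<Rightarrow> nat \<Rightarrow> real) \<Rightarrow>
   ('n, 'm) channels \<Rightarrow> ('n, 'm) action \<Rightarrow> (('n \<Rightarrow> bool) \<times> ('n, 'm) channels) pmf"
where
  "noise chan p H a =
     pair_pmf (Pi_pmf UNIV True (\<lambda>n. case a n of None \<Rightarrow> return_pmf True
        | Some m \<Rightarrow> bernoulli_pmf (p n m (H n m)))) chan"

definition successor ::
  "('n, 'm) state \<Rightarrow> ('n \<Rightarrow> bool) \<times> ('n, 'm) channels \<Rightarrow> ('n, 'm) state"
where
  "successor s w = (\<lambda>n. if fst w n then fst s n + 1 else 1, snd w)"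

text \<open>The noise depends on the state only through its channel matrix. Hence two states with
  equal matrices and a common action can be driven by the same noise, which is the coupling.\<close>

lemma transition_eq_map_noise:
  "transition chan p s a = map_pmf (successor s) (noise chan p (snd s) a)"
proof -
  let ?B = "\<lambda>n. case a n of None \<Rightarrow> return_pmf True | Some m \<Rightarrow> bernoulli_pmf (p n m (snd s n m))"
  let ?age = "\<lambda>n dropped. if dropped then fst s n + 1 else 1"
  have "next_aoi p s a n = ?B n \<bind> (\<lambda>d. return_pmf (?age n d))" for n
    by (auto simp: next_aoi_def map_pmf_def bind_return_pmf split: option.split)
  then have "next_aoi p s a = (\<lambda>n. ?B n \<bind> (\<lambda>d. return_pmf (?age n d)))"
    by blast
  \<comment> \<open>Independent coordinates may be mapped coordinatewise; the defaults
    \<open>0\<close> and \<open>True\<close> never appear because the index set is all of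
    \<open>UNIV\<close>.\<close>
  then have "Pi_pmf UNIV 0 (next_aoi p s a) =
      Pi_pmf UNIV True ?B \<bind> (\<lambda>d. Pi_pmf UNIV 0 (\<lambda>n. return_pmf (?age n (d n))))"
    by (simp only: Pi_pmf_bind[where d' = True, OF finite])
  also have "\<dots> = map_pmf (\<lambda>d n. ?age n (d n)) (Pi_pmf UNIV True ?B)"
    by (simp add: map_pmf_def)
  finally have "transition chan p s a =
      map_pmf (apfst (\<lambda>d n. ?age n (d n))) (pair_pmf (Pi_pmf UNIV True ?B) chan)"
    by (simp add: transition_def pair_map_pmf1)
  also have "apfst (\<lambda>d n. ?age n (d n)) = successor s"
    by (auto simp: fun_eq_iff successor_def)
  finally show ?thesis
    by (simp add: noise_def)
qed

lemma successor_in_states: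
  assumes "set_pmf chan \<subseteq> channel_matrices hmax" "w \<in> set_pmf (noise chan p H a)"
  shows "successor s w \<in> states hmax"
  using assms by (auto simp: noise_def successor_def states_def)

lemma set_transition_subset:
  assumes "set_pmf chan \<subseteq> channel_matrices hmax"
  shows "set_pmf (transition chan p s a) \<subseteq> states hmax"
  unfolding transition_eq_map_noise set_map_pmf
  by (intro image_subsetI successor_in_states[OF assms])

text \<open>
  If \<open>v\<close> are the previous ages in the simulated process and \<open>s\<close> is the
  current state of the real one, then \<open>lagged v s\<close> is the current simulated state.
\<close>

definition lagged :: "('n \<Rightarrow> nat) \<Rightarrow> ('n, 'm) state \<Rightarrow> ('n, 'm) state" where
  "lagged v s = (\<lambda>n. if fst s n = 1 then 1 else v n + 1, snd s)"

text \<open>The fold replays the past states to recover the previous simulated ages. The parameter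
  \<open>v\<close> supplies those ages before the first observed state, where the history is still
  empty.\<close>

definition mimic ::
  "(('n, 'm) state \<Rightarrow> ('n, 'm) action) \<Rightarrow> ('n \<Rightarrow> nat) \<Rightarrow> (('n, 'm) state, ('n, 'm) action) policy"
where
  "mimic f v = (\<lambda>hist s. return_pmf (f (lagged (foldl (\<lambda>v x. fst (lagged v (fst x))) v hist) s)))"

text \<open>After one step the continuation is again a \<open>mimic\<close> policy with updated
  ages, as the recursion of \<open>state_law\<close> requires.\<close>

lemma mimic_Cons: "mimic f v (x # hist) = mimic f (fst (lagged v (fst x))) hist"
  by (simp add: mimic_def)

text \<open>Nothing is assumed about \<open>v\<close>, so \<open>mimic\<close> is admissible on
  every history, including unreachable ones.\<close>

lemma lagged_in_states: "s \<in> states hmax \<Longrightarrow> lagged v s \<in> states hmax"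
  by (auto simp: lagged_def states_def)

lemma admissible_mimic:
  assumes "f \<in> states hmax \<rightarrow> A"
  shows "admissible_policy (states hmax) A (mimic f v)"
  using funcset_mem[OF assms lagged_in_states] by (auto simp: admissible_policy_def mimic_def)

text \<open>Ages in \<open>s\<close> are at least 1, so an age that is not reset becomes at least 2.
  Thus a new age equal to 1 reveals a reset, and the simulated step can be rebuilt from the real
  one.\<close>

lemma lagged_successor:
  assumes "s \<in> states hmax"
  shows "lagged (fst s') (successor s w) = successor s' w"
proof -
  have pos: "fst s n \<noteq> 0" for n
    using assms by (auto simp: states_def Suc_le_eq)
  show ?thesis
    by (auto simp: pos lagged_def successor_def fun_eq_iff)
qed

section \<open>Comparison of the real and the simulated process\<close>

definition age_mono_on :: "('n, 'm) state set \<Rightarrow> (('n, 'm) state \<Rightarrow> 'b::order) \<Rightarrow> bool" where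
  "age_mono_on S c \<longleftrightarrow>
     (\<forall>s\<in>S. \<forall>s'\<in>S. snd s = snd s' \<longrightarrow> fst s \<le> fst s' \<longrightarrow> c s \<le> c s')"

lemma age_mono_onD:
  "age_mono_on S c \<Longrightarrow> s \<in> S \<Longrightarrow> s' \<in> S \<Longrightarrow> snd s = snd s' \<Longrightarrow> fst s \<le> fst s' \<Longrightarrow> c s \<le> c s'"
  by (simp add: age_mono_on_def)

text \<open>The bound on \<open>fst s n\<close> is the invariant of the coupling: it says that no
  device in \<open>s\<close> is older than in \<open>lagged v s\<close>, and it survives each step
  under shared noise.\<close>

lemma nn_integral_state_law_mimic_le:
  assumes chan: "set_pmf chan \<subseteq> channel_matrices hmax"
    and c: "age_mono_on (states hmax) c"
    and "s \<in> states hmax" and "\<And>n. fst s n \<le> v n + 1"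
  shows "(\<integral>\<^sup>+x. c x \<partial>state_law (transition chan p) t (mimic f v) s)
       \<le> (\<integral>\<^sup>+x. c x \<partial>state_law (transition chan p) t (stationary f) (lagged v s))"
  using assms(3,4)
proof (induction t arbitrary: v s)
  case 0
  have "fst s \<le> fst (lagged v s)"
    using 0 by (auto simp: le_fun_def lagged_def)
  then have "c s \<le> c (lagged v s)"
    using 0 by (intro age_mono_onD[OF c] lagged_in_states) (auto simp: lagged_def)
  then show ?case by simp
next
  case (Suc t)
  let ?s' = "lagged v s"
  \<comment> \<open>One noise law serves both processes: \<open>mimic\<close> plays
    \<open>f ?s'\<close> in \<open>s\<close>, \<open>stationary f\<close> plays it in
    \<open>?s'\<close>, and \<open>lagged\<close> keeps the channel matrix.\<close>
  let ?N = "noise chan p (snd s) (f ?s')"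
  let ?D = "\<lambda>\<sigma> x. \<integral>\<^sup>+y. c y \<partial>state_law (transition chan p) t \<sigma> x"
  have "(\<integral>\<^sup>+x. c x \<partial>state_law (transition chan p) (Suc t) (mimic f v) s) =
      (\<integral>\<^sup>+w. ?D (mimic f (fst ?s')) (successor s w) \<partial>?N)"
    by (simp add: mimic_Cons transition_eq_map_noise) (simp add: mimic_def)
  also have "\<dots> \<le> (\<integral>\<^sup>+w. ?D (stationary f) (successor ?s' w) \<partial>?N)"
  proof (intro nn_integral_mono_AE, simp only: AE_measure_pmf_iff, intro ballI)
    fix w assume w: "w \<in> set_pmf ?N"
    have "fst s n \<le> fst ?s' n" for n
      using Suc.prems(2) by (auto simp: lagged_def)
    \<comment> \<open>The invariant one step later, with the current simulated ages
      \<open>fst ?s'\<close> in the role of \<open>v\<close>.\<close>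
    then have "fst (successor s w) n \<le> fst ?s' n + 1" for n
      by (simp add: successor_def)
    then have "?D (mimic f (fst ?s')) (successor s w) \<le>
        ?D (stationary f) (lagged (fst ?s') (successor s w))"
      by (intro Suc.IH successor_in_states[OF chan w])
    then show "?D (mimic f (fst ?s')) (successor s w) \<le> ?D (stationary f) (successor ?s' w)"
      by (simp only: lagged_successor[OF Suc.prems(1)])
  qed
  also have "\<dots> = (\<integral>\<^sup>+x. c x \<partial>state_law (transition chan p) (Suc t) (stationary f) ?s')"
    by (simp add: stationary_def transition_eq_map_noise bind_return_pmf)
      (simp add: lagged_def)
  finally show ?case .
qed

section \<open>Sign and age monotonicity of the one-step cost\<close>

lemma reward_nonpos:
  assumes "\<And>i k. 1 \<le> k \<Longrightarrow> 0 < g i k" and "s \<in> states hmax"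
  shows "reward g s \<le> 0"
proof -
  have "0 < g i (fst s i)" for i
    using assms(2) by (intro assms(1)) (auto simp: states_def)
  then show ?thesis
    by (simp add: reward_def sum_nonneg less_imp_le)
qed

lemma age_mono_cost:
  assumes "\<And>i. mono_on {1..} (g i)"
  shows "age_mono_on (states hmax) (\<lambda>s. ennreal (- reward g s))"
  unfolding age_mono_on_def
proof (intro ballI impI)
  fix s s' :: "('a, 'b) state"
  assume "s \<in> states hmax" "s' \<in> states hmax" "fst s \<le> fst s'"
  then have "g i (fst s i) \<le> g i (fst s' i)" for i
    by (intro mono_onD[OF assms]) (auto simp: states_def le_fun_def)
  then show "ennreal (- reward g s) \<le> ennreal (- reward g s')"
    by (auto simp: reward_def intro!: ennreal_leI sum_mono)
qed

theorem theorem1: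
  fixes hmax :: nat and \<gamma> :: real
    and chan :: "('n::finite, 'm::finite) channels pmf"
    and q :: "'n \<Rightarrow> 'm \<Rightarrow> nat \<Rightarrow> real"
    and p :: "'n \<Rightarrow> 'm \<Rightarrow> nat \<Rightarrow> real"
    and g :: "'n \<Rightarrow> nat \<Rightarrow> real"
    and \<pi> :: "('n, 'm) state \<Rightarrow> ('n, 'm) action"
    and a :: "('n, 'm) action"
    and \<tau> :: "'n \<Rightarrow> nat" and \<tau>' :: nat and H :: "('n, 'm) channels" and n :: 'n
  assumes "CARD('m) < CARD('n)"
    and "1 \<le> hmax"
    and "0 < \<gamma>" and "\<gamma> < 1"
    and "set_pmf chan \<subseteq> channel_matrices hmax"
    and "\<And>i m j. j \<in> {1..hmax} \<Longrightarrow> pmf (map_pmf (\<lambda>H. H i m) chan) j = q i m j"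
    and "\<And>i m. (\<Sum>j = 1..hmax. q i m j) = 1"
    and "\<And>i m h. h \<in> {1..hmax} \<Longrightarrow> p i m h \<in> {0..1}"
    and "\<And>i m. mono_on {1..hmax} (p i m)"
    and "\<And>i k. 1 \<le> k \<Longrightarrow> 0 < g i k"
    and "\<And>i. mono_on {1..} (g i)"
    and "optimal_stationary (states hmax) actions (transition chan p) (reward g) \<gamma> \<pi>"
    and "\<And>s. s \<in> states hmax \<Longrightarrow> \<bar>V_fun (transition chan p) (reward g) \<gamma> \<pi> s\<bar> \<noteq> \<infinity>"
    and "\<And>s b. s \<in> states hmax \<Longrightarrow> b \<in> actions \<Longrightarrow>
           \<bar>Q_fun (transition chan p) (reward g) \<gamma> \<pi> s b\<bar> \<noteq> \<infinity>"
    and "a \<in> actions"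
    and "(\<tau>, H) \<in> states hmax"
    and "\<tau> n \<le> \<tau>'"
  shows "Q_fun (transition chan p) (reward g) \<gamma> \<pi> (\<tau>(n := \<tau>'), H) a
       \<le> Q_fun (transition chan p) (reward g) \<gamma> \<pi> (\<tau>, H) a"
proof -
  let ?S = "states hmax :: ('n, 'm) state set" and ?A = "actions :: ('n, 'm) action set"
  let ?K = "transition chan p"
  let ?s = "(\<tau>, H)" and ?s' = "(\<tau>(n := \<tau>'), H)"
  define c :: "('n, 'm) state \<Rightarrow> ennreal" where "c = (\<lambda>x. ennreal (- reward g x))"
  note chan = \<open>set_pmf chan \<subseteq> channel_matrices hmax\<close>
  note optimal = \<open>optimal_stationary ?S ?A ?K (reward g) \<gamma> \<pi>\<close>
  have \<pi>: "\<pi> \<in> ?S \<rightarrow> ?A"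
    using optimal by (simp add: optimal_stationary_def)
  have c: "age_mono_on ?S c"
    unfolding c_def by (rule age_mono_cost) fact
  have value_eq: "policy_value ?K (reward g) \<gamma> \<sigma> s = - enn2ereal (expected_cost ?K c \<gamma> \<sigma> s)"
    if "admissible_policy ?S ?A \<sigma>" "s \<in> ?S" for \<sigma> s
    unfolding c_def
  proof (rule policy_value_eq_expected_cost[OF that])
    show "set_pmf (?K x b) \<subseteq> ?S" for x b
      by (rule set_transition_subset[OF chan])
    show "reward g x \<le> 0" if "x \<in> ?S" for x
      using assms(10) that by (rule reward_nonpos)
  qed (use \<open>0 < \<gamma>\<close> in simp)
  have adm: "admissible_policy ?S ?A (stationary \<pi>)" "admissible_policy ?S ?A (first_then a \<pi>)"
    using \<pi> \<open>a \<in> ?A\<close> by (auto simp: admissible_policy_def stationary_def first_then_def)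
  have s: "?s \<in> ?S" "?s' \<in> ?S"
    using \<open>?s \<in> ?S\<close> \<open>\<tau> n \<le> \<tau>'\<close> by (auto simp: states_def intro: order_trans)

  have mono: "expected_cost ?K c \<gamma> (stationary \<pi>) (successor ?s w)
      \<le> expected_cost ?K c \<gamma> (stationary \<pi>) (successor ?s' w)"
    if w: "w \<in> set_pmf (noise chan p H a)" for w
  proof -
    \<comment> \<open>\<open>?x\<close> is the younger process at time 1, and \<open>?v\<close>
      holds the ages of the older one at time 0.\<close>
    let ?x = "successor ?s w" and ?v = "fst ?s'"
    have x: "?x \<in> ?S"
      by (rule successor_in_states[OF chan w])
    \<comment> \<open>Optimality is applied at time 1, since the action at time 0 is prescribed. It
      must cover history-dependent competitors, because \<open>mimic\<close> uses the past.\<close>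
    have "policy_value ?K (reward g) \<gamma> (mimic \<pi> ?v) ?x
        \<le> policy_value ?K (reward g) \<gamma> (stationary \<pi>) ?x"
      using optimal x admissible_mimic[OF \<pi>] unfolding optimal_stationary_def by blast
    then have "expected_cost ?K c \<gamma> (stationary \<pi>) ?x \<le> expected_cost ?K c \<gamma> (mimic \<pi> ?v) ?x"
      by (simp add: value_eq[OF adm(1) x] value_eq[OF admissible_mimic[OF \<pi>] x] less_eq_ennreal.rep_eq)
    also have "\<dots> \<le> expected_cost ?K c \<gamma> (stationary \<pi>) (lagged ?v ?x)"
      unfolding expected_cost_def
    proof (intro suminf_le mult_left_mono nn_integral_state_law_mimic_le[OF chan c x])
      show "fst ?x i \<le> ?v i + 1" for i
        using \<open>\<tau> n \<le> \<tau>'\<close> by (simp add: successor_def)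
    qed simp_all
    also have "lagged ?v ?x = successor ?s' w"
      by (rule lagged_successor[OF s(1)])
    finally show ?thesis .
  qed
  have "c ?s \<le> c ?s'"
    using s \<open>\<tau> n \<le> \<tau>'\<close> by (intro age_mono_onD[OF c]) (auto simp: le_fun_def)
  \<comment> \<open>By the Bellman identity the immediate costs and the expected continuation costs
    are compared separately, the latter pointwise in the common noise. Negation then gives the
    inequality for \<open>Q_fun\<close>.\<close>
  then have "expected_cost ?K c \<gamma> (first_then a \<pi>) ?s \<le> expected_cost ?K c \<gamma> (first_then a \<pi>) ?s'"
    using \<open>0 < \<gamma>\<close> mono
    by (auto simp: expected_cost_first_then transition_eq_map_noise AE_measure_pmf_iff
        intro!: add_mono mult_left_mono nn_integral_mono_AE)
  then show ?thesis
    by (simp add: Q_fun_def value_eq[OF adm(2)] s less_eq_ennreal.rep_eq)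
qed

end
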